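(* Let $F$ be a compact subset of $\mathbb{C}^n$. If $F$ is $L$-regular at $b\in F$ and $b$ is a star center of $F$, i.e., $tF+(1-t)b\subset F$ for each $t\in[0,1]$, then $F$ is locally $L$-regular at $b$. Consequently, if $F$ is $L$-regular and convex, then $F$ is locally $L$-regular.
   Context: The Lelong class $\mathcal{L}$ is the set of plurisubharmonic functions $u$ on $\mathbb{C}^n$ such that for some constant $c_u$, $u(z)\le\max\{0,\log\|z\|\}+c_u$ for all $z\in\mathbb{C}^n$. For $E\subset\mathbb{C}^n$, the Siciak–Zaharjuta extremal function is $L_E(z)=\sup\{u(z):u\in\mathcal{L},\ u|_E\le 0\}$, $z\in\mathbb{C}^n$ (possibly $+\infty$). $\bar{\mathbb{B}}(a,r)$ is the closed Euclidean ball of center $a$ and radius $r\in(0,\infty]$ (equal to $\mathbb{C}^n$ for $r=\infty$). For $E\subset\mathbb{C}^n$ and $a\in\bar E$: $E$ is $L$-regular at $a$ if $L_E$ is continuous at $a$ (equivalently $L_E^*(a)=0$, where $^*$ denotes upper semicontinuous regularization); $E$ is locally $L$-regular at $a$ if $L_{E\cap\bar{\mathbb{B}}(a,r)}$ is continuous at $a$ for each $r\in(0,\infty]$. $E$ is $L$-regular (resp. locally $L$-regular) if it is $L$-regular (resp. locally $L$-regular) at every point of $\bar E$. *)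

theory Defs
  imports "HOL-Analysis.Analysis"
begin

definition upper_semicontinuous :: "('a::topological_space \<Rightarrow> ereal) \<Rightarrow> bool" where
  "upper_semicontinuous u \<longleftrightarrow> (\<forall>c. open {z. u z < c})"

(* The normalized Lebesgue integral over the circle {a + exp(i t) w}: positive part minus
   negative part (e2ennreal truncates at 0).  If u is upper semicontinuous and < \<infinity>, it is
   bounded above on the circle, so \<infinity> - \<infinity> does not occur. *)
definition circle_mean :: "(complex ^ 'n \<Rightarrow> ereal) \<Rightarrow> complex ^ 'n \<Rightarrow> complex ^ 'n \<Rightarrow> ereal" where
  "circle_mean u a w =
     enn2ereal (\<integral>\<^sup>+ t. e2ennreal (u (a + cis t *s w)) \<partial>uniform_measure lborel {0..2 * pi})
   - enn2ereal (\<integral>\<^sup>+ t. e2ennreal (- u (a + cis t *s w)) \<partial>uniform_measure lborel {0..2 * pi})"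

(* Plurisubharmonic on the whole space.  The constant -\<infinity> is admitted; this does not affect
   the extremal function below, for which the constant 0 is always a competitor. *)
definition plurisubharmonic :: "(complex ^ 'n \<Rightarrow> ereal) \<Rightarrow> bool" where
  "plurisubharmonic u \<longleftrightarrow>
     (\<forall>z. u z < \<infinity>) \<and> upper_semicontinuous u \<and> (\<forall>a w. u a \<le> circle_mean u a w)"

(* ln 0 = 0 is harmless here: the maximum at z = 0 is 0, as it should be. *)
definition Lelong_class :: "(complex ^ 'n \<Rightarrow> ereal) set" where
  "Lelong_class =
     {u. plurisubharmonic u \<and> (\<exists>c::real. \<forall>z. u z \<le> ereal (max 0 (ln (norm z)) + c))}"

definition extremal_function :: "(complex ^ 'n) set \<Rightarrow> complex ^ 'n \<Rightarrow> ereal" where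
  "extremal_function E z = (SUP u \<in> {u \<in> Lelong_class. \<forall>x\<in>E. u x \<le> 0}. u z)"

definition closed_ball :: "'a::metric_space \<Rightarrow> ereal \<Rightarrow> 'a set" where
  "closed_ball a r = {z. ereal (dist a z) \<le> r}"

(* The two pointwise notions are meant for points a of the closure of E. *)
definition L_regular_at :: "(complex ^ 'n) set \<Rightarrow> complex ^ 'n \<Rightarrow> bool" where
  "L_regular_at E a \<longleftrightarrow> isCont (extremal_function E) a"

definition locally_L_regular_at :: "(complex ^ 'n) set \<Rightarrow> complex ^ 'n \<Rightarrow> bool" where
  "locally_L_regular_at E a \<longleftrightarrow>
     (\<forall>r::ereal. 0 < r \<longrightarrow> isCont (extremal_function (E \<inter> closed_ball a r)) a)"

definition L_regular :: "(complex ^ 'n) set \<Rightarrow> bool" where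
  "L_regular E \<longleftrightarrow> (\<forall>a\<in>closure E. L_regular_at E a)"

definition locally_L_regular :: "(complex ^ 'n) set \<Rightarrow> bool" where
  "locally_L_regular E \<longleftrightarrow> (\<forall>a\<in>closure E. locally_L_regular_at E a)"

definition star_center :: "'a::real_vector set \<Rightarrow> 'a \<Rightarrow> bool" where
  "star_center F b \<longleftrightarrow>
     b \<in> F \<and> (\<forall>t\<in>{0..1::real}. (\<lambda>x. t *\<^sub>R x + (1 - t) *\<^sub>R b) ` F \<subseteq> F)"

end

theory Submission
  imports Defs
begin

text \<open>
  The class of competitors is stable under composition with affine maps. If \<open>t > 0\<close> is small,
  the contraction \<open>x \<mapsto> b + t (x - b)\<close> maps \<open>F\<close> into its part \<open>E\<close> in the ball of
  radius \<open>r\<close> around the star center \<open>b\<close>, so \<open>0 \<le> L\<^sub>E(z) \<le> L\<^sub>F(b + (z - b)/t)\<close>,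
  and the right-hand side tends to \<open>L\<^sub>F(b) = 0\<close> as \<open>z\<close> tends to \<open>b\<close>.
\<close>

lemma upper_semicontinuous_compose:
  assumes "upper_semicontinuous u" "continuous_on UNIV f"
  shows "upper_semicontinuous (\<lambda>z. u (f z))"
  using assms open_vimage[of "{y. u y < c}" f for c]
  by (auto simp: upper_semicontinuous_def vimage_def)

text \<open>Real scaling commutes with the rotations \<open>cis s\<close>, so the affine map carries
  each circle to a circle with the same parametrization and the integrands coincide.\<close>

lemma circle_mean_affine:
  "circle_mean (\<lambda>z. u (c + t *\<^sub>R z)) a w = circle_mean u (c + t *\<^sub>R a) (t *\<^sub>R w)"
proof -
  have "c + t *\<^sub>R (a + cis s *s w) = c + t *\<^sub>R a + cis s *s (t *\<^sub>R w)" for s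
    by (simp add: vec_eq_iff algebra_simps)
  then show ?thesis
    by (simp only: circle_mean_def)
qed

lemma plurisubharmonic_affine:
  assumes "plurisubharmonic u"
  shows "plurisubharmonic (\<lambda>z. u (c + t *\<^sub>R z))"
  using assms
  using upper_semicontinuous_compose[of u "\<lambda>z. c + t *\<^sub>R z"]
  by (simp add: plurisubharmonic_def circle_mean_affine continuous_on_add continuous_on_scaleR)

lemma log_growth_affine:
  fixes c z :: "'a::real_normed_vector"
  shows "max 0 (ln (norm (c + t *\<^sub>R z))) \<le> max 0 (ln (norm z)) + ln (1 + norm c + \<bar>t\<bar>)"
proof -
  \<comment> \<open>This turns the additive estimate into a multiplicative one; at
    \<open>x = 0\<close> it relies on \<open>ln 0 = 0\<close>.\<close>
  have max_ln: "max 0 (ln x) = ln (max 1 x)" if "0 \<le> x" for x :: real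
    using that by (cases "x = 0") (auto simp: max_def)
  let ?m = "max 1 (norm z)"
  have "norm (c + t *\<^sub>R z) \<le> norm c + \<bar>t\<bar> * norm z"
    using norm_triangle_ineq[of c "t *\<^sub>R z"] by simp
  also have "\<dots> \<le> norm c * ?m + \<bar>t\<bar> * ?m"
    by (intro add_mono mult_left_mono mult_left_mono[of 1 ?m "norm c", simplified]) auto
  \<comment> \<open>The summand 1 covers the case where the maximum on the left is 1, and it keeps
    the factor positive even for \<open>c = 0\<close> and \<open>t = 0\<close>.\<close>
  finally have "max 1 (norm (c + t *\<^sub>R z)) \<le> ?m * (1 + norm c + \<bar>t\<bar>)"
    by (auto simp: algebra_simps intro: add_increasing2 add_increasing)
  then have "ln (max 1 (norm (c + t *\<^sub>R z))) \<le> ln (?m * (1 + norm c + \<bar>t\<bar>))"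
    by (subst ln_le_cancel_iff) auto
  also have "\<dots> = ln ?m + ln (1 + norm c + \<bar>t\<bar>)"
    by (intro ln_mult_pos) (auto simp: add_pos_nonneg)
  finally show ?thesis
    by (simp add: max_ln)
qed

lemma Lelong_class_affine:
  assumes "u \<in> Lelong_class"
  shows "(\<lambda>z. u (c + t *\<^sub>R z)) \<in> Lelong_class"
proof -
  from assms obtain k where psh: "plurisubharmonic u"
    and k: "\<And>z. u z \<le> ereal (max 0 (ln (norm z)) + k)"
    by (auto simp: Lelong_class_def)
  have "u (c + t *\<^sub>R z) \<le> ereal (max 0 (ln (norm z)) + (ln (1 + norm c + \<bar>t\<bar>) + k))" for z
  proof (rule order_trans[OF k])
    show "ereal (max 0 (ln (norm (c + t *\<^sub>R z))) + k)
        \<le> ereal (max 0 (ln (norm z)) + (ln (1 + norm c + \<bar>t\<bar>) + k))"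
      using log_growth_affine[of c t z] by simp
  qed
  with plurisubharmonic_affine[OF psh] show ?thesis
    unfolding Lelong_class_def by blast
qed

text \<open>This competitor, admissible for every set, supplies the lower bound in the squeeze at
  \<open>b\<close>.\<close>

lemma zero_in_Lelong_class: "(\<lambda>_. 0) \<in> Lelong_class"
proof -
  have "\<exists>c::real. \<forall>z::complex ^ 'n. 0 \<le> ereal (max 0 (ln (norm z)) + c)"
    by (rule exI[of _ 0]) (simp add: zero_ereal_def le_max_iff_disj del: ereal_max)
  then show ?thesis
    by (simp add: Lelong_class_def plurisubharmonic_def upper_semicontinuous_def circle_mean_def)
qed

lemma extremal_function_nonneg: "0 \<le> extremal_function E z"
  unfolding extremal_function_def
  by (rule SUP_upper2[of "\<lambda>_. 0"]) (auto simp: zero_in_Lelong_class)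

lemma extremal_function_eq_0: "z \<in> E \<Longrightarrow> extremal_function E z = 0"
  by (intro antisym extremal_function_nonneg) (auto simp: extremal_function_def intro: SUP_least)

text \<open>Precomposition with the affine map turns every competitor for \<open>E\<close> into a
  competitor for \<open>F\<close>.\<close>

lemma extremal_function_affine_le:
  assumes "(\<lambda>x. c + t *\<^sub>R x) ` F \<subseteq> E"
  shows "extremal_function E (c + t *\<^sub>R z) \<le> extremal_function F z"
  unfolding extremal_function_def
proof (rule SUP_least)
  fix u assume "u \<in> {u \<in> Lelong_class. \<forall>x\<in>E. u x \<le> 0}"
  with assms Lelong_class_affine[of u c t]
  have "(\<lambda>x. u (c + t *\<^sub>R x)) \<in> {u \<in> Lelong_class. \<forall>x\<in>F. u x \<le> 0}"
    by auto
  then show "u (c + t *\<^sub>R z) \<le> (SUP v\<in>{u \<in> Lelong_class. \<forall>x\<in>F. u x \<le> 0}. v z)"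
    by (rule SUP_upper2) simp
qed

lemma isCont_extremal_function_affine:
  assumes cont: "isCont (extremal_function F) b" and b: "b \<in> F"
    and t: "t \<noteq> 0" and sub: "(\<lambda>x. (1 - t) *\<^sub>R b + t *\<^sub>R x) ` F \<subseteq> E"
  shows "isCont (extremal_function E) b"
proof -
  \<comment> \<open>The inverse of the homothety with center \<open>b\<close> and ratio
    \<open>t\<close>; it also fixes \<open>b\<close>.\<close>
  define g where "g z = b + (1 / t) *\<^sub>R (z - b)" for z
  have g: "(1 - t) *\<^sub>R b + t *\<^sub>R g z = z" for z
    using t by (simp add: g_def algebra_simps)
  have "b \<in> E"
    using sub b by (auto simp: algebra_simps dest!: subsetD[where c = b])
  have "isCont g b"
    unfolding g_def by (intro continuous_intros)
  moreover have "g b = b"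
    by (simp add: g_def)
  ultimately have "isCont (\<lambda>z. extremal_function F (g z)) b"
    using cont isCont_o2[of b g "extremal_function F"] by simp
  then have lim: "(\<lambda>z. extremal_function F (g z)) \<midarrow>b\<rightarrow> 0"
    by (simp add: isCont_def \<open>g b = b\<close> extremal_function_eq_0[OF b])
  have "extremal_function E z \<le> extremal_function F (g z)" for z
    using extremal_function_affine_le[OF sub, of "g z"] by (simp add: g)
  then have "extremal_function E \<midarrow>b\<rightarrow> 0"
    by (intro tendsto_sandwich[OF _ _ tendsto_const lim] always_eventually allI
        extremal_function_nonneg)
  then show ?thesis
    by (simp add: isCont_def extremal_function_eq_0 \<open>b \<in> E\<close>)
qed

lemma bounded_contraction_subset_closed_ball:
  fixes F :: "'a::real_normed_vector set"
  assumes "bounded F" "0 < r"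
  obtains t where "0 < t" "t \<le> 1" "(\<lambda>x. (1 - t) *\<^sub>R b + t *\<^sub>R x) ` F \<subseteq> closed_ball b r"
proof -
  \<comment> \<open>Since \<open>r\<close> may be infinite, a real radius below it is chosen
    first.\<close>
  obtain s where s: "0 < s" "ereal s < r"
    using ereal_dense2[OF \<open>0 < r\<close>] by auto
  obtain R0 where R0: "\<And>x. x \<in> F \<Longrightarrow> dist b x \<le> R0"
    using \<open>bounded F\<close> by (auto simp: bounded_any_center[of F b])
  \<comment> \<open>The maximum makes division by \<open>R\<close> safe, for instance when
    \<open>F\<close> is just the point \<open>b\<close>.\<close>
  define R where "R = max 1 R0"
  have R: "0 < R" "\<And>x. x \<in> F \<Longrightarrow> dist b x \<le> R"
    using R0 by (force simp: R_def)+
  \<comment> \<open>The ratio \<open>s / R\<close> shrinks distances up to \<open>R\<close> to at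
    most \<open>s\<close>; the cap 1 keeps \<open>t\<close> in the range allowed for a star
    center.\<close>
  define t where "t = min 1 (s / R)"
  have t: "0 < t" "t \<le> 1" "t * R \<le> s"
    using s R by (auto simp: t_def min_def field_simps)
  have "(1 - t) *\<^sub>R b + t *\<^sub>R x \<in> closed_ball b r" if "x \<in> F" for x
  proof -
    have "b - ((1 - t) *\<^sub>R b + t *\<^sub>R x) = t *\<^sub>R (b - x)"
      by (simp add: algebra_simps)
    then have "dist b ((1 - t) *\<^sub>R b + t *\<^sub>R x) = t * dist b x"
      using t by (simp add: dist_norm)
    also have "\<dots> \<le> t * R"
      using R(2)[OF that] t by simp
    also have "\<dots> \<le> s"
      by (rule t)
    finally have "ereal (dist b ((1 - t) *\<^sub>R b + t *\<^sub>R x)) \<le> ereal s"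
      by simp
    also have "\<dots> < r"
      by (rule s)
    finally show ?thesis
      by (simp add: closed_ball_def)
  qed
  with t that show thesis
    by blast
qed

text \<open>Boundedness lets a contracted copy of \<open>F\<close> fit into the ball, and the star
  center keeps that copy inside \<open>F\<close>.\<close>

lemma star_center_locally_L_regular_at:
  assumes "bounded F" "L_regular_at F b" "star_center F b"
  shows "locally_L_regular_at F b"
  unfolding locally_L_regular_at_def
proof (intro allI impI)
  fix r :: ereal assume "0 < r"
  obtain t where t: "0 < t" "t \<le> 1"
    and ball: "(\<lambda>x. (1 - t) *\<^sub>R b + t *\<^sub>R x) ` F \<subseteq> closed_ball b r"
    by (rule bounded_contraction_subset_closed_ball[OF assms(1) \<open>0 < r\<close>])
  have "(\<lambda>x. (1 - t) *\<^sub>R b + t *\<^sub>R x) ` F \<subseteq> F"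
    using assms(3) t by (simp add: star_center_def add.commute)
  with ball have sub: "(\<lambda>x. (1 - t) *\<^sub>R b + t *\<^sub>R x) ` F \<subseteq> F \<inter> closed_ball b r"
    by (rule Int_greatest[rotated])
  have "isCont (extremal_function F) b" "b \<in> F"
    using assms(2,3) by (simp_all add: L_regular_at_def star_center_def)
  then show "isCont (extremal_function (F \<inter> closed_ball b r)) b"
    using t(1) by (intro isCont_extremal_function_affine[OF _ _ _ sub]) auto
qed

lemma convex_imp_star_center: "convex F \<Longrightarrow> b \<in> F \<Longrightarrow> star_center F b"
  by (auto simp: star_center_def intro!: convexD)

theorem theorem1p7:
  fixes F :: "(complex ^ 'n) set"
  assumes "compact F"
  shows "(\<forall>b\<in>F. L_regular_at F b \<and> star_center F b \<longrightarrow> locally_L_regular_at F b)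
    \<and> (L_regular F \<and> convex F \<longrightarrow> locally_L_regular F)"
  \<comment> \<open>Closedness identifies \<open>closure F\<close> with \<open>F\<close>, so in the
    convex case every point to be checked is a star center.\<close>
  using compact_imp_bounded[OF assms] compact_imp_closed[OF assms]
  by (auto simp: L_regular_def locally_L_regular_def closure_closed
      intro: star_center_locally_L_regular_at convex_imp_star_center)

end
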